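(* Let $F\subset\mathbb{R}^n$ be a closed bounded convex set containing the origin in its interior, and let $\Omega,\Omega_1,\ldots,\Omega_m$ be nonempty closed convex subsets of $\mathbb{R}^n$ such that $\bigcap_{i=1}^m(\Omega\cap\Omega_i)=\emptyset$ and at least one of the sets $\Omega,\Omega_1,\ldots,\Omega_m$ is bounded. Let $\mathcal{D}_F(x):=\max\{d_F(x;\Omega_i)\mid i=1,\ldots,m\}$ and, for $p>0$ and $x\in\mathbb{R}^n$, let $$\mathcal{D}_F(x,p):=p\ln\sum_{i=1}^m\exp\left(\frac{\sqrt{d_F(x;\Omega_i)^2+p^2}}{p}\right).$$ Then the following hold. (i) If $x\in\mathbb{R}^n$ and $0<p_1<p_2$, then $\mathcal{D}_F(x,p_1)<\mathcal{D}_F(x,p_2)$. (ii) For any $x\in\mathbb{R}^n$ and $p>0$, $0\le \mathcal{D}_F(x,p)-\mathcal{D}_F(x)\le p(1+\ln m)$. (iii) For any $p>0$, the function $\mathcal{D}_F(\cdot,p)$ is convex. If, further, $F$ is normally smooth and the sets $\Omega_i$, $i=1,\ldots,m$, are strictly convex and not collinear (i.e., there is no straight line that intersects all the sets $\Omega_i$), then $\mathcal{D}_F(\cdot,p)$ is strictly convex. (iv) For any $p>0$, if $F$ is normally smooth and normally round, then $\mathcal{D}_F(\cdot,p)$ is continuously differentiable on $\mathbb{R}^n$. (v) If at least one of the target sets $\Omega_i$, $i=1,\ldots,m$, is bounded, then for any $p>0$ the function $\mathcal{D}_F(\cdot,p)$ is coercive, in the sense that $\lim_{\|x\|\to\inf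ty}\mathcal{D}_F(x,p)=\infty$.
   Context: $\mathbb{R}^n$ carries the Euclidean norm $\|\cdot\|$ and inner product $\langle\cdot,\cdot\rangle$. The support function of $F$ is $\sigma_F(x):=\sup\{\langle x,f\rangle\mid f\in F\}$. For nonempty $Q\subset\mathbb{R}^n$, the generalized distance is $d_F(x;Q):=\inf\{\sigma_F(x-q)\mid q\in Q\}$. The normal cone to $F$ at $x\in F$ is $N(x;F):=\{v\in\mathbb{R}^n\mid \langle v,y-x\rangle\le 0\ \forall y\in F\}$, and $\mathrm{cone}\{v\}:=\{\lambda v\mid\lambda\ge 0\}$. $F$ is normally smooth if for every $x\in\mathrm{bd}\,F$ there exists $a_x\in\mathbb{R}^n$ such that $N(x;F)=\mathrm{cone}\{a_x\}$. $F$ is normally round if $N(x;F)\neq N(y;F)$ whenever $x,y\in\mathrm{bd}\,F$, $x\neq y$. A closed convex set $Q$ is strictly convex if $tu+(1-t)v\in\mathrm{int}\,Q$ whenever $u,v\in Q$, $u\neq v$, $t\in(0,1)$. *)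

theory Defs
  imports "HOL-Analysis.Analysis"
begin

text \<open>
  Suprema and infima are taken in the conditionally complete reals. They are the usual ones when
  \<open>F\<close> is bounded with \<open>0 \<in> F\<close> and \<open>Q\<close> is nonempty, since then
  \<open>0 \<le> support_function F x < \<infinity>\<close>.
\<close>

definition support_function :: "'a::real_inner set \<Rightarrow> 'a \<Rightarrow> real" where
  "support_function F x = (SUP f\<in>F. x \<bullet> f)"

definition gen_dist :: "'a::real_inner set \<Rightarrow> 'a \<Rightarrow> 'a set \<Rightarrow> real" where
  "gen_dist F x Q = (INF q\<in>Q. support_function F (x - q))"

definition normal_cone :: "'a::real_inner \<Rightarrow> 'a set \<Rightarrow> 'a set" where
  "normal_cone x F = {v. \<forall>y\<in>F. v \<bullet> (y - x) \<le> 0}"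

definition ray :: "'a::real_vector \<Rightarrow> 'a set" where
  "ray v = {c *\<^sub>R v | c. 0 \<le> c}"

definition normally_smooth :: "'a::real_inner set \<Rightarrow> bool" where
  "normally_smooth F \<longleftrightarrow> (\<forall>x\<in>frontier F. \<exists>a. normal_cone x F = ray a)"

definition normally_round :: "'a::real_inner set \<Rightarrow> bool" where
  "normally_round F \<longleftrightarrow>
     (\<forall>x\<in>frontier F. \<forall>y\<in>frontier F. x \<noteq> y \<longrightarrow> normal_cone x F \<noteq> normal_cone y F)"

definition strictly_convex_set :: "'a::real_normed_vector set \<Rightarrow> bool" where
  "strictly_convex_set Q \<longleftrightarrow> closed Q \<and> convex Q \<and>
     (\<forall>u\<in>Q. \<forall>v\<in>Q. \<forall>t. u \<noteq> v \<and> 0 < t \<and> t < 1 \<longrightarrow> t *\<^sub>R u + (1 - t) *\<^sub>R v \<in> interior Q)"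

definition strictly_convex_fun :: "('a::real_vector \<Rightarrow> real) \<Rightarrow> bool" where
  "strictly_convex_fun f \<longleftrightarrow>
     (\<forall>x y t. x \<noteq> y \<and> 0 < t \<and> t < 1 \<longrightarrow>
        f (t *\<^sub>R x + (1 - t) *\<^sub>R y) < t * f x + (1 - t) * f y)"

text \<open>
  A property of the family of sets, unlike the library's \<open>collinear\<close>, which concerns the points
  of a single set. Straight lines are the affine sets of dimension one.
\<close>

definition collinear_sets :: "nat \<Rightarrow> (nat \<Rightarrow> 'a::euclidean_space set) \<Rightarrow> bool" where
  "collinear_sets m T \<longleftrightarrow> (\<exists>L. affine L \<and> aff_dim L = 1 \<and> (\<forall>i\<in>{1..m}. L \<inter> T i \<noteq> {}))"

definition continuously_differentiable :: "('a::real_inner \<Rightarrow> real) \<Rightarrow> bool" where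
  "continuously_differentiable f \<longleftrightarrow>
     (\<exists>G. (\<forall>x. GDERIV f x :> G x) \<and> continuous_on UNIV G)"

definition max_dist :: "'a::real_inner set \<Rightarrow> nat \<Rightarrow> (nat \<Rightarrow> 'a set) \<Rightarrow> 'a \<Rightarrow> real" where
  "max_dist F m T x = Max ((\<lambda>i. gen_dist F x (T i)) ` {1..m})"

definition smooth_max_dist ::
    "'a::real_inner set \<Rightarrow> nat \<Rightarrow> (nat \<Rightarrow> 'a set) \<Rightarrow> 'a \<Rightarrow> real \<Rightarrow> real" where
  "smooth_max_dist F m T x p =
     p * ln (\<Sum>i=1..m. exp (sqrt ((gen_dist F x (T i))\<^sup>2 + p\<^sup>2) / p))"

end

theory Submission
  imports Defs
begin

text \<open>
  Parts (i), (ii) and (v) are estimates for \<open>log-sum-exp\<close>; in (i) the scaling in \<open>p\<close> is the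
  monotonicity of the \<open>\<ell>\<^sup>r\<close> norms in \<open>r\<close>.

  Equality in the convexity inequality of (iii) on a segment forces every distance \<open>d\<^sub>F(\<cdot>; \<Omega>\<^sub>i)\<close> to
  take equal values at the end points and at the interior point. For strictly convex targets and
  normally smooth \<open>F\<close> the common value can only be \<open>0\<close>, so that the line through the segment meets
  every target.

  For (iv), smoothness and roundness of \<open>F\<close> make the maximizer defining \<open>\<sigma>\<^sub>F\<close> unique, hence
  \<open>\<sigma>\<^sub>F\<^sup>2\<close> is differentiable. A convex function below a differentiable one is differentiable at every
  point of contact, and a differentiable convex function is continuously differentiable.
\<close>

section \<open>Convex functions and their gradients\<close>

text \<open>The majorant bounds the remainder of \<open>\<phi>\<close> from above. For the lower
  bound, reflect \<open>y\<close> through \<open>x\<close> to \<open>z\<close>: midpoint convexity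
  gives \<open>\<phi> y \<ge> 2 * \<phi> x - \<phi> z\<close>, and the upper bound at
  \<open>z\<close> applies because \<open>D\<close> is odd.\<close>

lemma convex_on_has_derivative_sandwich:
  fixes \<phi> \<psi> :: "'a::real_normed_vector \<Rightarrow> real"
  assumes "convex_on UNIV \<phi>" and le: "\<And>y. \<phi> y \<le> \<psi> y" and eq: "\<phi> x = \<psi> x"
    and D: "(\<psi> has_derivative D) (at x)"
  shows "(\<phi> has_derivative D) (at x)"
  unfolding has_derivative_at_alt
proof (intro conjI allI impI)
  show "bounded_linear D" using D by (rule has_derivative_bounded_linear)
  fix e :: real assume "0 < e"
  then obtain d where "0 < d"
    and d: "\<And>y. norm (y - x) < d \<Longrightarrow> norm (\<psi> y - \<psi> x - D (y - x)) \<le> e * norm (y - x)"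
    using D unfolding has_derivative_at_alt by blast
  have "norm (\<phi> y - \<phi> x - D (y - x)) \<le> e * norm (y - x)" if y: "norm (y - x) < d" for y
  proof -
    define z where "z = 2 *\<^sub>R x - y"
    have zx: "z - x = - (y - x)" by (simp add: z_def scaleR_2)
    have n: "norm (z - x) = norm (y - x)" unfolding zx by (rule norm_minus_cancel)
    have "D (z - x) = - D (y - x)"
      unfolding zx by (rule linear_neg[OF has_derivative_linear[OF D]])
    moreover have "x = (1/2) *\<^sub>R y + (1/2) *\<^sub>R z"
      by (simp add: z_def scaleR_diff_right)
    with convex_onD[OF assms(1), of "1/2" y z] have "\<phi> x \<le> (\<phi> y + \<phi> z) / 2"
      by simp
    moreover note d[OF y] d[of z] n y le[of y] le[of z] eq
    ultimately show ?thesis by (simp add: abs_le_iff)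
  qed
  with \<open>0 < d\<close> show "\<exists>d>0. \<forall>y. norm (y - x) < d \<longrightarrow>
      norm (\<phi> y - \<phi> x - D (y - x)) \<le> e * norm (y - x)"
    by blast
qed

text \<open>Restriction to the line through \<open>x\<close> and \<open>y\<close> reduces this to
  the tangent inequality in one real variable.\<close>

lemma convex_on_above_gradient:
  fixes f :: "'a::real_inner \<Rightarrow> real"
  assumes "convex_on UNIV f" and "GDERIV f x :> g"
  shows "f x + (y - x) \<bullet> g \<le> f y"
proof -
  define k where "k s = f (x + s *\<^sub>R (y - x))" for s
  have "convex_on UNIV k"
  proof (rule convex_onI)
    fix t a b :: real assume t: "0 < t" "t < 1"
    have "x + ((1 - t) *\<^sub>R a + t *\<^sub>R b) *\<^sub>R (y - x) =
        (1 - t) *\<^sub>R (x + a *\<^sub>R (y - x)) + t *\<^sub>R (x + b *\<^sub>R (y - x))"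
      by (simp add: algebra_simps)
    then show "k ((1 - t) *\<^sub>R a + t *\<^sub>R b) \<le> (1 - t) * k a + t * k b"
      unfolding k_def using convex_onD[OF assms(1)] t by simp
  qed simp
  moreover have "(k has_real_derivative (y - x) \<bullet> g) (at 0)"
  proof -
    have "((\<lambda>s. x + s *\<^sub>R (y - x)) has_derivative (\<lambda>s. s *\<^sub>R (y - x))) (at 0)"
      by (auto intro!: derivative_eq_intros)
    moreover have "(f has_derivative (\<lambda>h. h \<bullet> g)) (at (x + 0 *\<^sub>R (y - x)))"
      using assms(2) by (simp add: gderiv_def)
    ultimately have "((\<lambda>s. f (x + s *\<^sub>R (y - x))) has_derivative (\<lambda>s. s *\<^sub>R (y - x) \<bullet> g)) (at 0)"
      by (rule has_derivative_compose)
    then show ?thesis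
      by (simp add: k_def[abs_def] has_field_derivative_def mult_commute_abs)
  qed
  ultimately have "k 1 - k 0 \<ge> (y - x) \<bullet> g * (1 - 0)"
    by (intro convex_on_imp_above_tangent[where A = UNIV]) auto
  then show ?thesis by (simp add: k_def)
qed

text \<open>
  The remainder estimate at \<open>x\<close>, used at \<open>y\<close> and at a point at distance \<open>\<delta>\<close> from \<open>y\<close>,
  together with the subgradient inequality at \<open>y\<close>, bounds \<open>G y - G x\<close> without any compactness.
\<close>

lemma convex_on_continuous_gradient:
  fixes f :: "'a::real_inner \<Rightarrow> real"
  assumes "convex_on UNIV f" and G: "\<And>x. GDERIV f x :> G x"
  shows "continuous_on UNIV G"
  unfolding continuous_on_iff
proof (intro ballI allI impI)
  fix x and e :: real assume "0 < e"
  have "(f has_derivative (\<lambda>h. h \<bullet> G x)) (at x)"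
    using G[of x] by (simp add: gderiv_def)
  then obtain d where "0 < d"
    and d: "\<And>y. norm (y - x) < d \<Longrightarrow> \<bar>f y - f x - (y - x) \<bullet> G x\<bar> \<le> e / 4 * norm (y - x)"
    unfolding has_derivative_at_alt using \<open>0 < e\<close>
    by (metis divide_pos_pos real_norm_def zero_less_numeral)
  \<comment> \<open>Both \<open>y\<close> and the auxiliary point \<open>z\<close> lie within
    \<open>2 * \<delta> < d\<close> of \<open>x\<close>, so one remainder estimate serves both. The
    two errors add up to \<open>3 / 4 * e * \<delta>\<close>.\<close>
  define \<delta> where "\<delta> = d / 3"
  have "0 < \<delta>" using \<open>0 < d\<close> by (simp add: \<delta>_def)
  have "dist (G y) (G x) < e" if y: "dist y x < \<delta>" for y
  proof -
    \<comment> \<open>The direction of the gradient change, which turns the inner product with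
      \<open>G y - G x\<close> into its norm. It is \<open>0\<close> when the gradients agree, hence
      only \<open>norm w \<le> 1\<close>.\<close>
    define w where "w = sgn (G y - G x)"
    define z where "z = y + \<delta> *\<^sub>R w"
    have "norm w \<le> 1" by (simp add: w_def norm_sgn)
    then have nz: "norm (z - y) \<le> \<delta>" using \<open>0 < \<delta>\<close> by (simp add: z_def)
    have ny: "norm (y - x) \<le> \<delta>" using y by (simp add: dist_norm)
    have nzx: "norm (z - x) \<le> 2 * \<delta>"
      using norm_triangle_ineq[of "z - y" "y - x"] nz ny by simp
    have w: "w \<bullet> (G y - G x) = norm (G y - G x)"
      by (cases "G y - G x = 0")
        (auto simp: w_def sgn_div_norm dot_square_norm power2_eq_square)
    have "f y + (z - y) \<bullet> G y \<le> f z"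
      by (rule convex_on_above_gradient[OF assms(1) G])
    moreover have "(z - y) \<bullet> G y = \<delta> * norm (G y - G x) + (z - x) \<bullet> G x - (y - x) \<bullet> G x"
      unfolding w[symmetric] by (simp add: z_def algebra_simps inner_diff_right inner_add_left)
    moreover have "\<bar>f y - f x - (y - x) \<bullet> G x\<bar> \<le> e / 4 * \<delta>"
      using d[of y] ny \<open>0 < \<delta>\<close> mult_left_mono[OF ny, of "e / 4"] \<open>0 < e\<close>
      unfolding \<delta>_def by linarith
    moreover have "\<bar>f z - f x - (z - x) \<bullet> G x\<bar> \<le> e / 4 * (2 * \<delta>)"
      using d[of z] nzx \<open>0 < \<delta>\<close> mult_left_mono[OF nzx, of "e / 4"] \<open>0 < e\<close>
      unfolding \<delta>_def by linarith
    ultimately have "\<delta> * norm (G y - G x) \<le> 3 * (e / 4 * \<delta>)"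
      by linarith
    with \<open>0 < \<delta>\<close> have "norm (G y - G x) \<le> 3 / 4 * e" by (simp add: field_simps)
    with \<open>0 < e\<close> show ?thesis by (simp add: dist_norm)
  qed
  with \<open>0 < \<delta>\<close> show "\<exists>d>0. \<forall>y\<in>UNIV. dist y x < d \<longrightarrow> dist (G y) (G x) < e"
    by blast
qed

text \<open>Riesz representation in coordinates: the components of \<open>g\<close> are the values
  of the derivative on the basis vectors.\<close>

lemma differentiable_imp_gderiv:
  fixes f :: "'a::euclidean_space \<Rightarrow> real"
  assumes "f differentiable (at x)"
  obtains g where "GDERIV f x :> g"
proof -
  from assms obtain D where D: "(f has_derivative D) (at x)"
    unfolding differentiable_def by blast
  then have lin: "linear D" by (rule has_derivative_linear)
  define g where "g = (\<Sum>b\<in>Basis. D b *\<^sub>R b)"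
  have "D h = h \<bullet> g" for h
  proof -
    have "D h = D (\<Sum>b\<in>Basis. (h \<bullet> b) *\<^sub>R b)" by (simp add: euclidean_representation)
    also have "\<dots> = h \<bullet> g"
      by (simp add: g_def linear_sum[OF lin] linear_scale[OF lin] inner_sum_right mult.commute)
    finally show ?thesis .
  qed
  then have "D = (\<lambda>h. h \<bullet> g)" by (rule ext)
  with D that show thesis by (simp add: gderiv_def)
qed

lemma convex_on_differentiable_imp_continuously_differentiable:
  fixes f :: "'a::euclidean_space \<Rightarrow> real"
  assumes "convex_on UNIV f" and "\<And>x. f differentiable (at x)"
  shows "continuously_differentiable f"
proof -
  have "\<exists>g. GDERIV f x :> g" for x
    using differentiable_imp_gderiv[OF assms(2)] by blast
  then have "\<exists>G. \<forall>x. GDERIV f x :> G x" by metis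
  then show ?thesis
    unfolding continuously_differentiable_def
    using convex_on_continuous_gradient[OF assms(1)] by blast
qed

section \<open>The smoothed maximum\<close>

text \<open>The root is the Euclidean norm of the vector \<open>(a, p)\<close>. Since
  \<open>a \<noteq> b\<close> and \<open>p > 0\<close>, the vectors \<open>(a, p)\<close> and
  \<open>(b, p)\<close> are not parallel, so the triangle inequality is strict.\<close>

lemma sqrt_sum_power2_strict_convex:
  fixes a b p t :: real
  assumes "a \<noteq> b" "0 < p" "0 < t" "t < 1"
  shows "sqrt ((t * a + (1 - t) * b)\<^sup>2 + p\<^sup>2) < t * sqrt (a\<^sup>2 + p\<^sup>2) + (1 - t) * sqrt (b\<^sup>2 + p\<^sup>2)"
proof -
  define A where "A = sqrt (a\<^sup>2 + p\<^sup>2)"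
  define B where "B = sqrt (b\<^sup>2 + p\<^sup>2)"
  have AB: "A\<^sup>2 = a\<^sup>2 + p\<^sup>2" "B\<^sup>2 = b\<^sup>2 + p\<^sup>2" "0 \<le> A" "0 \<le> B"
    by (simp_all add: A_def B_def)
  \<comment> \<open>Lagrange's identity: the second summand is the gap in the Cauchy-Schwarz
    inequality.\<close>
  have "(a * b + p\<^sup>2)\<^sup>2 + p\<^sup>2 * (a - b)\<^sup>2 = (A * B)\<^sup>2"
    unfolding power_mult_distrib AB by (simp add: power2_eq_square algebra_simps)
  moreover have "0 < p\<^sup>2 * (a - b)\<^sup>2" using assms by simp
  ultimately have "(a * b + p\<^sup>2)\<^sup>2 < (A * B)\<^sup>2" by linarith
  then have "a * b + p\<^sup>2 < A * B" using AB by (intro power2_less_imp_less[of "a * b + p\<^sup>2"]) auto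
  then have "0 < 2 * (t * (1 - t)) * (A * B - (a * b + p\<^sup>2))" using assms by simp
  moreover have "(t * A + (1 - t) * B)\<^sup>2 - ((t * a + (1 - t) * b)\<^sup>2 + p\<^sup>2) =
      t\<^sup>2 * A\<^sup>2 + (1 - t)\<^sup>2 * B\<^sup>2 + 2 * t * (1 - t) * A * B - ((t * a + (1 - t) * b)\<^sup>2 + p\<^sup>2)"
    by (simp add: power2_eq_square algebra_simps)
  moreover have "\<dots> = 2 * (t * (1 - t)) * (A * B - (a * b + p\<^sup>2))"
    unfolding AB by (simp add: power2_eq_square algebra_simps)
  ultimately have "(t * a + (1 - t) * b)\<^sup>2 + p\<^sup>2 < (t * A + (1 - t) * B)\<^sup>2" by linarith
  then show ?thesis
    unfolding A_def[symmetric] B_def[symmetric]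
    using AB assms by (intro real_less_lsqrt) auto
qed

text \<open>To be used with \<open>a\<close>, \<open>b\<close>, \<open>c\<close> the distances at
  the end points and at the interior point of a segment. Strictness comes from strict convexity if
  \<open>a \<noteq> b\<close>, and from strict monotonicity if \<open>a = b\<close> and
  \<open>c < a\<close>.\<close>

lemma sqrt_sum_power2_convex_mono:
  fixes a b c p t :: real
  assumes "0 < p" "0 < t" "t < 1" and c: "0 \<le> c" "c \<le> t * a + (1 - t) * b"
  shows "sqrt (c\<^sup>2 + p\<^sup>2) \<le> t * sqrt (a\<^sup>2 + p\<^sup>2) + (1 - t) * sqrt (b\<^sup>2 + p\<^sup>2)"
    and "a \<noteq> b \<or> c \<noteq> a \<Longrightarrow>
      sqrt (c\<^sup>2 + p\<^sup>2) < t * sqrt (a\<^sup>2 + p\<^sup>2) + (1 - t) * sqrt (b\<^sup>2 + p\<^sup>2)"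
proof -
  have 1: "sqrt (c\<^sup>2 + p\<^sup>2) \<le> sqrt ((t * a + (1 - t) * b)\<^sup>2 + p\<^sup>2)"
    using c by (simp add: power_mono)
  have ab: "t * a + (1 - t) * b = a" "t * sqrt (a\<^sup>2 + p\<^sup>2) + (1 - t) * sqrt (b\<^sup>2 + p\<^sup>2) = sqrt (a\<^sup>2 + p\<^sup>2)"
    if "a = b" using that by (simp_all add: algebra_simps)
  show "sqrt (c\<^sup>2 + p\<^sup>2) \<le> t * sqrt (a\<^sup>2 + p\<^sup>2) + (1 - t) * sqrt (b\<^sup>2 + p\<^sup>2)"
  proof (cases "a = b")
    case True
    then show ?thesis using 1 ab by simp
  next
    case False
    then show ?thesis using 1 sqrt_sum_power2_strict_convex[of a b p t] assms by linarith
  qed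
  show "sqrt (c\<^sup>2 + p\<^sup>2) < t * sqrt (a\<^sup>2 + p\<^sup>2) + (1 - t) * sqrt (b\<^sup>2 + p\<^sup>2)"
    if "a \<noteq> b \<or> c \<noteq> a"
  proof (cases "a = b")
    case True
    with that c ab have "c < a" by auto
    then show ?thesis using c unfolding ab(2)[OF True] by (simp add: power_strict_mono)
  next
    case False
    then show ?thesis using 1 sqrt_sum_power2_strict_convex[of a b p t] assms by linarith
  qed
qed

text \<open>Subtracting \<open>ln U\<close> and \<open>ln V\<close> from the exponents normalizes
  both exponential sums to 1. Convexity of \<open>exp\<close>, applied termwise and summed, then
  gives the claim.\<close>

lemma ln_sum_exp_convex:
  fixes u v :: "'i \<Rightarrow> real"
  assumes "finite I" "I \<noteq> {}" and t: "0 \<le> t" "t \<le> 1"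
  shows "ln (\<Sum>i\<in>I. exp (t * u i + (1 - t) * v i)) \<le>
    t * ln (\<Sum>i\<in>I. exp (u i)) + (1 - t) * ln (\<Sum>i\<in>I. exp (v i))"
proof -
  define U where "U = (\<Sum>i\<in>I. exp (u i))"
  define V where "V = (\<Sum>i\<in>I. exp (v i))"
  define W where "W = t * ln U + (1 - t) * ln V"
  have pos: "0 < U" "0 < V" using assms by (auto simp: U_def V_def intro!: sum_pos)
  have "exp (t * u i + (1 - t) * v i) \<le> exp W * (t * (exp (u i) / U) + (1 - t) * (exp (v i) / V))" for i
  proof -
    have "exp (t * u i + (1 - t) * v i) = exp W * exp (t * (u i - ln U) + (1 - t) * (v i - ln V))"
      by (simp add: W_def exp_add[symmetric] algebra_simps)
    also have "exp (t * (u i - ln U) + (1 - t) * (v i - ln V)) \<le>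
        t * exp (u i - ln U) + (1 - t) * exp (v i - ln V)"
      using convex_onD[OF exp_convex, of "1 - t" "u i - ln U" "v i - ln V"] t by simp
    finally show ?thesis using pos by (simp add: exp_diff)
  qed
  then have "(\<Sum>i\<in>I. exp (t * u i + (1 - t) * v i)) \<le>
      (\<Sum>i\<in>I. exp W * (t * (exp (u i) / U) + (1 - t) * (exp (v i) / V)))"
    by (rule sum_mono)
  also have "\<dots> = exp W * (t * (U / U) + (1 - t) * (V / V))"
    unfolding sum_distrib_left[symmetric] sum.distrib sum_divide_distrib[symmetric] U_def V_def ..
  also have "\<dots> = exp W" using pos by simp
  finally have "ln (\<Sum>i\<in>I. exp (t * u i + (1 - t) * v i)) \<le> ln (exp W)"
    using assms by (subst ln_le_cancel_iff) (auto intro!: sum_pos)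
  then show ?thesis by (simp add: W_def U_def V_def)
qed

lemma ln_sum_exp_mono:
  fixes u v :: "'i \<Rightarrow> real"
  assumes "finite I" "I \<noteq> {}" and le: "\<And>i. i \<in> I \<Longrightarrow> u i \<le> v i"
  shows "ln (\<Sum>i\<in>I. exp (u i)) \<le> ln (\<Sum>i\<in>I. exp (v i))"
  using assms by (subst ln_le_cancel_iff) (auto intro!: sum_pos sum_mono)

lemma ln_sum_exp_strict_mono:
  fixes u v :: "'i \<Rightarrow> real"
  assumes "finite I" and "\<And>i. i \<in> I \<Longrightarrow> u i \<le> v i"
    and "j \<in> I" "u j < v j"
  shows "ln (\<Sum>i\<in>I. exp (u i)) < ln (\<Sum>i\<in>I. exp (v i))"
  using assms by (subst ln_less_cancel_iff) (auto intro!: sum_pos sum_strict_mono_ex1)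

text \<open>The left side is the logarithm of the \<open>1/p\<close>-norm of the numbers
  \<open>exp (a i)\<close>, and such norms decrease in the exponent. Indeed each term
  \<open>exp (a i / q)\<close> is at most the sum \<open>S\<close>, and this bound may be raised to
  the power \<open>q / p - 1 \<ge> 0\<close>.\<close>

lemma scaled_ln_sum_exp_mono:
  fixes a :: "'i \<Rightarrow> real"
  assumes "finite I" "I \<noteq> {}" "0 < p" "p \<le> q"
  shows "p * ln (\<Sum>i\<in>I. exp (a i / p)) \<le> q * ln (\<Sum>i\<in>I. exp (a i / q))"
proof -
  define S where "S = (\<Sum>i\<in>I. exp (a i / q))"
  have "0 < S" using assms by (auto simp: S_def intro!: sum_pos)
  have "exp (a i / p) \<le> S powr (q / p - 1) * exp (a i / q)" if "i \<in> I" for i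
  proof -
    have "exp (a i / p) = exp (a i / q) powr (q / p - 1) * exp (a i / q)"
      using assms by (simp add: powr_def exp_add[symmetric] field_simps)
    also have "\<dots> \<le> S powr (q / p - 1) * exp (a i / q)"
      using that assms by (intro mult_right_mono powr_mono2) (auto simp: S_def intro!: member_le_sum)
    finally show ?thesis .
  qed
  then have "(\<Sum>i\<in>I. exp (a i / p)) \<le> S powr (q / p - 1) * S"
    unfolding S_def sum_distrib_left by (rule sum_mono)
  also have "\<dots> = S powr (q / p)"
    using \<open>0 < S\<close> by (simp add: powr_diff)
  finally have "ln (\<Sum>i\<in>I. exp (a i / p)) \<le> ln (S powr (q / p))"
    using assms \<open>0 < S\<close> by (subst ln_le_cancel_iff) (auto intro!: sum_pos)
  also have "\<dots> = q / p * ln S" using \<open>0 < S\<close> by (simp add: ln_powr)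
  finally show ?thesis using assms by (simp add: S_def field_simps)
qed

section \<open>Support functions and generalized distances\<close>

text \<open>Lets the unnamed generator of a normal cone in a normally smooth set be replaced by any
  nonzero normal.\<close>

lemma ray_eqI:
  assumes "x \<in> ray a" "x \<noteq> 0"
  shows "ray a = ray x"
proof -
  obtain c where c: "x = c *\<^sub>R a" "0 < c"
    using assms by (force simp: ray_def less_le)
  show ?thesis
  proof
    show "ray x \<subseteq> ray a"
    proof
      fix v assume "v \<in> ray x"
      then obtain k where "0 \<le> k" "v = k *\<^sub>R x" by (auto simp: ray_def)
      with c have "0 \<le> k * c \<and> v = (k * c) *\<^sub>R a" by simp
      then show "v \<in> ray a" unfolding ray_def by blast
    qed
    show "ray a \<subseteq> ray x"
    proof
      fix v assume "v \<in> ray a"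
      then obtain k where "0 \<le> k" "v = k *\<^sub>R a" by (auto simp: ray_def)
      with c have "0 \<le> k / c \<and> v = (k / c) *\<^sub>R x" by simp
      then show "v \<in> ray x" unfolding ray_def by blast
    qed
  qed
qed

text \<open>Compactness provides maximizers and an upper bound by a multiple of the norm; the
  interior origin provides a positive lower bound. The support function is thus a possibly
  asymmetric norm.\<close>

locale gauge_body =
  fixes F :: "'a::euclidean_space set"
  assumes compact: "compact F" and zero_interior: "0 \<in> interior F"
begin

section \<open>The support function: attainment, sublinearity, comparison with the norm\<close>

lemma inner_le_support_function:
  assumes "f \<in> F"
  shows "x \<bullet> f \<le> support_function F x"
proof -
  have "compact ((\<lambda>f. x \<bullet> f) ` F)"
    by (intro compact_continuous_image compact continuous_intros)
  then show ?thesis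
    unfolding support_function_def using assms
    by (intro cSUP_upper bounded_imp_bdd_above compact_imp_bounded)
qed

lemma support_function_attained:
  obtains f where "f \<in> F" "support_function F x = x \<bullet> f"
proof -
  have "F \<noteq> {}" using zero_interior interior_subset by blast
  moreover have "continuous_on F (\<lambda>f. x \<bullet> f)" by (intro continuous_intros)
  ultimately obtain f where "f \<in> F" "\<And>g. g \<in> F \<Longrightarrow> x \<bullet> g \<le> x \<bullet> f"
    using continuous_attains_sup[OF compact, of "\<lambda>f. x \<bullet> f"] by blast
  then have "support_function F x = x \<bullet> f"
    unfolding support_function_def by (intro cSup_eq_maximum) auto
  with \<open>f \<in> F\<close> that show thesis by blast
qed

lemma support_function_add:
  "support_function F (x + y) \<le> support_function F x + support_function F y"
proof -
  obtain f where f: "f \<in> F" "support_function F (x + y) = (x + y) \<bullet> f"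
    by (rule support_function_attained)
  then show ?thesis
    using inner_le_support_function[OF f(1), of x] inner_le_support_function[OF f(1), of y]
    by (simp add: inner_add_left)
qed

lemma support_function_scaleR:
  assumes "0 \<le> c"
  shows "support_function F (c *\<^sub>R x) = c * support_function F x"
proof (rule antisym)
  obtain f where f: "f \<in> F" "support_function F (c *\<^sub>R x) = (c *\<^sub>R x) \<bullet> f"
    by (rule support_function_attained)
  then show "support_function F (c *\<^sub>R x) \<le> c * support_function F x"
    using mult_left_mono[OF inner_le_support_function[OF f(1), of x] assms] by simp
  obtain g where g: "g \<in> F" "support_function F x = x \<bullet> g"
    by (rule support_function_attained)
  then show "c * support_function F x \<le> support_function F (c *\<^sub>R x)"
    using inner_le_support_function[OF g(1), of "c *\<^sub>R x"] by simp
qed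

lemma support_function_convex_combination:
  assumes "0 \<le> t" "t \<le> 1"
  shows "support_function F (t *\<^sub>R x + (1 - t) *\<^sub>R y) \<le>
    t * support_function F x + (1 - t) * support_function F y"
  using support_function_add[of "t *\<^sub>R x" "(1 - t) *\<^sub>R y"] assms
  by (simp add: support_function_scaleR)

lemma continuous_on_support_function: "continuous_on UNIV (support_function F)"
proof (rule convex_on_continuous)
  show "convex_on UNIV (support_function F)"
  proof (rule convex_onI)
    fix t x y assume "0 < (t::real)" "t < 1"
    then show "support_function F ((1 - t) *\<^sub>R x + t *\<^sub>R y) \<le>
        (1 - t) * support_function F x + t * support_function F y"
      using support_function_convex_combination[of "1 - t" x y] by simp
  qed simp
qed simp

lemma support_function_norm_le:
  "\<exists>M>0. \<forall>x. support_function F x \<le> M * norm x"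
proof -
  obtain M where M: "0 < M" "\<And>f. f \<in> F \<Longrightarrow> norm f \<le> M"
    using compact_imp_bounded[OF compact] unfolding bounded_pos by blast
  have "support_function F x \<le> M * norm x" for x
  proof -
    obtain f where f: "f \<in> F" "support_function F x = x \<bullet> f"
      by (rule support_function_attained)
    have "x \<bullet> f \<le> norm x * norm f" by (rule norm_cauchy_schwarz)
    also have "\<dots> \<le> norm x * M" using M f by (intro mult_left_mono) auto
    finally show ?thesis using f by (simp add: mult.commute)
  qed
  with M(1) show ?thesis by blast
qed

text \<open>A ball inside \<open>F\<close> contains a multiple of \<open>sgn x\<close> as test
  point. The bound is the source of attainment, definiteness and coercivity of the generalized
  distance.\<close>

lemma norm_le_support_function:
  "\<exists>c>0. \<forall>x. c * norm x \<le> support_function F x"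
proof -
  obtain c where c: "0 < c" "cball 0 c \<subseteq> F"
    using zero_interior unfolding mem_interior_cball by blast
  have "c * norm x \<le> support_function F x" for x
  proof -
    have "c *\<^sub>R sgn x \<in> cball 0 c" using c by (simp add: norm_sgn)
    then have "x \<bullet> (c *\<^sub>R sgn x) \<le> support_function F x"
      using c inner_le_support_function by blast
    moreover have "x \<bullet> sgn x = norm x"
      by (cases "x = 0") (auto simp: sgn_div_norm dot_square_norm power2_eq_square)
    ultimately show ?thesis by simp
  qed
  with c show ?thesis by blast
qed

lemma support_function_nonneg: "0 \<le> support_function F x"
  using norm_le_support_function by (meson mult_nonneg_nonneg less_imp_le norm_ge_zero order_trans)

lemma support_function_zero: "support_function F 0 = 0"
  using support_function_scaleR[of 0 0] by simp

section \<open>Maximizers, normal cones and strictness\<close>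

lemma maximizer_in_frontier:
  assumes "f \<in> F" "support_function F x = x \<bullet> f" "x \<noteq> 0"
  shows "f \<in> frontier F"
proof -
  have "f \<notin> interior F"
  proof
    assume "f \<in> interior F"
    then obtain c where c: "0 < c" "cball f c \<subseteq> F"
      unfolding mem_interior_cball by blast
    have "f + c *\<^sub>R sgn x \<in> cball f c" using c by (simp add: norm_sgn dist_norm)
    then have "x \<bullet> (f + c *\<^sub>R sgn x) \<le> x \<bullet> f"
      using c inner_le_support_function assms(2) by (metis subsetD)
    moreover have "0 < x \<bullet> (c *\<^sub>R sgn x)"
      using assms(3) c by (auto simp: sgn_div_norm)
    ultimately show False by (simp add: inner_add_right)
  qed
  then show ?thesis
    using assms(1) closure_subset by (auto simp: frontier_def)
qed

lemma maximizer_normal_cone: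
  assumes "f \<in> F" "support_function F x = x \<bullet> f"
  shows "x \<in> normal_cone f F"
  using inner_le_support_function[of _ x] assms by (auto simp: normal_cone_def inner_diff_right)

lemma normal_cone_maximizer:
  assumes "normally_smooth F" "f \<in> F" "support_function F x = x \<bullet> f" "x \<noteq> 0"
  shows "normal_cone f F = ray x"
proof -
  obtain a where "normal_cone f F = ray a"
    using assms maximizer_in_frontier unfolding normally_smooth_def by blast
  then show ?thesis
    using maximizer_normal_cone[OF assms(2,3)] ray_eqI[OF _ assms(4)] by auto
qed

text \<open>By smoothness the normal cones at both maximizers equal \<open>ray x\<close>; roundness
  then identifies the two frontier points.\<close>

lemma maximizer_unique:
  assumes "normally_smooth F" "normally_round F" "x \<noteq> 0"
    and "f \<in> F" "support_function F x = x \<bullet> f"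
    and "g \<in> F" "support_function F x = x \<bullet> g"
  shows "f = g"
  using assms normal_cone_maximizer maximizer_in_frontier unfolding normally_round_def by metis

text \<open>A maximizer \<open>f\<close> for the convex combination must also be one for
  \<open>x\<close> and for \<open>y\<close>. Both are then normals at \<open>f\<close>, so by
  smoothness they lie on one ray, and the common nonzero value \<open>r\<close> fixes the
  scale.\<close>

lemma support_function_strict:
  assumes "normally_smooth F" and t: "0 < t" "t < 1"
    and eq: "support_function F x = r" "support_function F y = r"
      "support_function F (t *\<^sub>R x + (1 - t) *\<^sub>R y) = r"
    and "r \<noteq> 0"
  shows "x = y"
proof -
  obtain f where f: "f \<in> F" "support_function F (t *\<^sub>R x + (1 - t) *\<^sub>R y) = (t *\<^sub>R x + (1 - t) *\<^sub>R y) \<bullet> f"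
    by (rule support_function_attained)
  have le: "x \<bullet> f \<le> r" "y \<bullet> f \<le> r"
    using inner_le_support_function[OF f(1)] eq by metis+
  have sum: "t * (r - x \<bullet> f) + (1 - t) * (r - y \<bullet> f) = 0"
    using f(2) eq(3) by (simp add: inner_add_left algebra_simps)
  have "0 \<le> t * (r - x \<bullet> f)" "0 \<le> (1 - t) * (r - y \<bullet> f)" using le t by simp_all
  with sum have "t * (r - x \<bullet> f) = 0" "(1 - t) * (r - y \<bullet> f) = 0" by linarith+
  then have xf: "x \<bullet> f = r" "y \<bullet> f = r" using t by simp_all
  have "x \<noteq> 0" "y \<noteq> 0" using eq \<open>r \<noteq> 0\<close> support_function_zero by auto
  then have "ray x = normal_cone f F" "y \<in> normal_cone f F"
    using normal_cone_maximizer[OF assms(1) f(1)] maximizer_normal_cone[OF f(1)] xf eq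
    by metis+
  then obtain k where k: "0 \<le> k" "y = k *\<^sub>R x" by (auto simp: ray_def)
  with eq have "r = k * r" using support_function_scaleR by metis
  with \<open>r \<noteq> 0\<close> k show ?thesis by simp
qed

text \<open>An argument of Danskin type: by compactness and uniqueness, the maximizers at points
  near \<open>x\<close> are close to \<open>f\<close>, which controls the remainder.\<close>

lemma support_function_has_derivative:
  assumes f: "f \<in> F" "support_function F x = x \<bullet> f"
    and unique: "\<And>g. g \<in> F \<Longrightarrow> support_function F x = x \<bullet> g \<Longrightarrow> g = f"
  shows "(support_function F has_derivative (\<lambda>h. h \<bullet> f)) (at x)"
  unfolding has_derivative_at_alt
proof (intro conjI allI impI)
  show "bounded_linear (\<lambda>h. h \<bullet> f)" by (rule bounded_linear_inner_left)
  fix e :: real assume "0 < e"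
  obtain M where M: "0 < M" "\<And>f. f \<in> F \<Longrightarrow> norm f \<le> M"
    using compact_imp_bounded[OF compact] unfolding bounded_pos by blast
  \<comment> \<open>Outside the ball around \<open>f\<close>, compactness and uniqueness leave a
    positive gap below the maximum. If nothing of \<open>F\<close> lies outside, any gap will
    do.\<close>
  have "\<exists>\<delta>>0. \<forall>g\<in>F - ball f e. x \<bullet> g + \<delta> \<le> x \<bullet> f"
  proof (cases "F - ball f e = {}")
    case False
    moreover have "compact (F - ball f e)"
      using compact by (intro compact_diff) auto
    moreover have "continuous_on (F - ball f e) (\<lambda>f. x \<bullet> f)" by (intro continuous_intros)
    ultimately obtain g where g: "g \<in> F - ball f e"
      and max: "\<And>k. k \<in> F - ball f e \<Longrightarrow> x \<bullet> k \<le> x \<bullet> g"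
      using continuous_attains_sup[of "F - ball f e" "\<lambda>f. x \<bullet> f"] by blast
    have "g \<noteq> f" using g \<open>0 < e\<close> by auto
    then have "x \<bullet> g < x \<bullet> f"
      using unique[of g] g inner_le_support_function[of g x] f by force
    then show ?thesis
      using max by (intro exI[of _ "x \<bullet> f - x \<bullet> g"]) auto
  qed (auto intro: exI[of _ 1])
  then obtain \<delta> where "0 < \<delta>" and \<delta>: "\<And>g. g \<in> F \<Longrightarrow> g \<notin> ball f e \<Longrightarrow> x \<bullet> g + \<delta> \<le> x \<bullet> f"
    by blast
  have "norm (support_function F y - support_function F x - (y - x) \<bullet> f) \<le> e * norm (y - x)"
    \<comment> \<open>Since \<open>norm (g - f) \<le> 2 * M\<close>, this radius keeps
      \<open>(y - x) \<bullet> (g - f)\<close> below the gap, so a maximizer \<open>g\<close> at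
      \<open>y\<close> cannot lie outside the ball.\<close>
    if y: "norm (y - x) < \<delta> / (2 * M)" for y
  proof -
    obtain g where g: "g \<in> F" "support_function F y = y \<bullet> g"
      by (rule support_function_attained)
    have yf: "y \<bullet> f \<le> y \<bullet> g" and xg: "x \<bullet> g \<le> x \<bullet> f"
      using inner_le_support_function[OF f(1), of y] inner_le_support_function[OF g(1), of x] f g
      by simp_all
    have "norm (g - f) \<le> 2 * M"
      using norm_triangle_ineq4[of g f] M(2)[OF g(1)] M(2)[OF f(1)] by linarith
    then have "norm (y - x) * norm (g - f) \<le> norm (y - x) * (2 * M)"
      by (intro mult_left_mono) auto
    also have "\<dots> < \<delta>" using y M by (simp add: field_simps)
    finally have "(y - x) \<bullet> (g - f) < \<delta>"
      using norm_cauchy_schwarz[of "y - x" "g - f"] by linarith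
    then have "x \<bullet> f < x \<bullet> g + \<delta>"
      using yf by (simp add: inner_diff_left inner_diff_right)
    then have "norm (g - f) \<le> e"
      using \<delta>[OF g(1)] by (force simp: dist_norm norm_minus_commute)
    then have "norm (y - x) * norm (g - f) \<le> e * norm (y - x)"
      by (simp add: mult.commute[of "norm (y - x)"] mult_right_mono)
    then have "(y - x) \<bullet> (g - f) \<le> e * norm (y - x)"
      using norm_cauchy_schwarz[of "y - x" "g - f"] by linarith
    \<comment> \<open>The remainder \<open>y \<bullet> (g - f)\<close> is nonnegative because
      \<open>g\<close> is optimal at \<open>y\<close>, and at most
      \<open>(y - x) \<bullet> (g - f)\<close> because \<open>f\<close> is optimal at
      \<open>x\<close>.\<close>
    moreover have "support_function F y - support_function F x - (y - x) \<bullet> f = y \<bullet> g - y \<bullet> f"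
      using f g by (simp add: inner_diff_left)
    ultimately show ?thesis
      using yf xg by (simp add: inner_diff_left inner_diff_right)
  qed
  then show "\<exists>d>0. \<forall>y. norm (y - x) < d \<longrightarrow>
      norm (support_function F y - support_function F x - (y - x) \<bullet> f) \<le> e * norm (y - x)"
    using \<open>0 < \<delta>\<close> M by (intro exI[of _ "\<delta> / (2 * M)"]) auto
qed

text \<open>Squaring removes the kink of the support function at the origin.\<close>

lemma support_function_power2_differentiable:
  assumes "normally_smooth F" "normally_round F"
  shows "(\<lambda>x. (support_function F x)\<^sup>2) differentiable (at x)"
proof (cases "x = 0")
  case False
  obtain f where f: "f \<in> F" "support_function F x = x \<bullet> f"
    by (rule support_function_attained)
  then have "(support_function F has_derivative (\<lambda>h. h \<bullet> f)) (at x)"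
    using maximizer_unique[OF assms False] by (intro support_function_has_derivative) auto
  then show ?thesis
    by (intro differentiable_power differentiableI)
next
  case True
  obtain M where M: "0 < M" "\<And>x. support_function F x \<le> M * norm x"
    using support_function_norm_le by blast
  have "((\<lambda>x. (support_function F x)\<^sup>2) has_derivative (\<lambda>h. 0)) (at 0)"
    unfolding has_derivative_at_alt
  proof (intro conjI allI impI)
    fix e :: real assume "0 < e"
    \<comment> \<open>The square is at most \<open>M\<^sup>2 * (norm y)\<^sup>2\<close>, whence the
      radius.\<close>
    have "norm ((support_function F y)\<^sup>2) \<le> e * norm y" if y: "norm y < e / M\<^sup>2" for y
    proof -
      have "(support_function F y)\<^sup>2 \<le> (M * norm y)\<^sup>2"
        using M support_function_nonneg by (intro power_mono) auto
      also have "\<dots> = (M\<^sup>2 * norm y) * norm y" by (simp add: power2_eq_square)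
      also have "\<dots> \<le> e * norm y"
        using y M by (intro mult_right_mono) (auto simp: field_simps)
      finally show ?thesis by simp
    qed
    then show "\<exists>d>0. \<forall>y. norm (y - 0) < d \<longrightarrow>
        norm ((support_function F y)\<^sup>2 - (support_function F 0)\<^sup>2 - 0) \<le> e * norm (y - 0)"
      using \<open>0 < e\<close> M by (intro exI[of _ "e / M\<^sup>2"]) (auto simp: support_function_zero)
  qed simp
  then show ?thesis unfolding True differentiable_def by blast
qed

section \<open>The generalized distance: attainment, convexity, coercivity\<close>

lemma gen_dist_le:
  assumes "q \<in> Q"
  shows "gen_dist F x Q \<le> support_function F (x - q)"
  unfolding gen_dist_def using assms support_function_nonneg
  by (intro cINF_lower bdd_belowI2[where m = 0])

text \<open>Points of \<open>Q\<close> outside \<open>cball x R\<close> are farther away than the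
  reference point \<open>q\<^sub>0\<close>, so a minimum over the compact part \<open>K\<close> is a
  minimum over \<open>Q\<close>.\<close>

lemma gen_dist_attained:
  assumes "closed Q" "Q \<noteq> {}"
  obtains q where "q \<in> Q" "gen_dist F x Q = support_function F (x - q)"
proof -
  obtain c where c: "0 < c" "\<And>x. c * norm x \<le> support_function F x"
    using norm_le_support_function by blast
  obtain q\<^sub>0 where q\<^sub>0: "q\<^sub>0 \<in> Q" using assms by blast
  define R where "R = support_function F (x - q\<^sub>0) / c"
  define K where "K = Q \<inter> cball x R"
  have far: "support_function F (x - q\<^sub>0) < support_function F (x - q)" if "q \<in> Q" "q \<notin> K" for q
  proof -
    have "R < norm (x - q)" using that by (auto simp: K_def dist_norm)
    then show ?thesis using c(1) c(2)[of "x - q"] by (simp add: R_def field_simps)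
  qed
  have "compact K" unfolding K_def using assms by (intro closed_Int_compact) auto
  moreover have "q\<^sub>0 \<in> K" using far q\<^sub>0 by blast
  moreover have "continuous_on K (\<lambda>q. support_function F (x - q))"
    by (rule continuous_on_compose2[OF continuous_on_support_function]) (auto intro: continuous_intros)
  ultimately obtain q where q: "q \<in> K"
    and min: "\<And>k. k \<in> K \<Longrightarrow> support_function F (x - q) \<le> support_function F (x - k)"
    using continuous_attains_inf by (metis empty_iff)
  have "support_function F (x - q) \<le> support_function F (x - k)" if "k \<in> Q" for k
    using min[of k] min[OF \<open>q\<^sub>0 \<in> K\<close>] far[OF that] by fastforce
  then have "gen_dist F x Q = support_function F (x - q)"
    unfolding gen_dist_def using q by (intro cInf_eq_minimum) (auto simp: K_def)
  then show thesis using q that by (auto simp: K_def)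
qed

lemma gen_dist_nonneg:
  assumes "Q \<noteq> {}"
  shows "0 \<le> gen_dist F x Q"
  unfolding gen_dist_def using assms support_function_nonneg by (intro cINF_greatest)

text \<open>The convex combination of projections of \<open>x\<close> and \<open>y\<close> lies in
  \<open>Q\<close> and is a competitor for the combined point.\<close>

lemma gen_dist_convex_combination:
  assumes Q: "closed Q" "convex Q" "Q \<noteq> {}" and t: "0 \<le> t" "t \<le> 1"
  shows "gen_dist F (t *\<^sub>R x + (1 - t) *\<^sub>R y) Q \<le> t * gen_dist F x Q + (1 - t) * gen_dist F y Q"
proof -
  obtain u where u: "u \<in> Q" "gen_dist F x Q = support_function F (x - u)"
    using gen_dist_attained[OF Q(1,3)] by blast
  obtain v where v: "v \<in> Q" "gen_dist F y Q = support_function F (y - v)"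
    using gen_dist_attained[OF Q(1,3)] by blast
  have "t *\<^sub>R u + (1 - t) *\<^sub>R v \<in> Q"
    using convexD[OF Q(2) u(1) v(1)] t by simp
  then have "gen_dist F (t *\<^sub>R x + (1 - t) *\<^sub>R y) Q \<le>
      support_function F (t *\<^sub>R x + (1 - t) *\<^sub>R y - (t *\<^sub>R u + (1 - t) *\<^sub>R v))"
    by (rule gen_dist_le)
  also have "t *\<^sub>R x + (1 - t) *\<^sub>R y - (t *\<^sub>R u + (1 - t) *\<^sub>R v) = t *\<^sub>R (x - u) + (1 - t) *\<^sub>R (y - v)"
    by (simp add: algebra_simps)
  finally show ?thesis
    using support_function_convex_combination[OF t, of "x - u" "y - v"] u v by simp
qed

lemma gen_dist_zero_imp_mem:
  assumes "closed Q" "Q \<noteq> {}" "gen_dist F x Q = 0"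
  shows "x \<in> Q"
proof -
  obtain q where q: "q \<in> Q" "gen_dist F x Q = support_function F (x - q)"
    using gen_dist_attained[OF assms(1,2)] by blast
  obtain c where c: "0 < c" "\<And>x. c * norm x \<le> support_function F x"
    using norm_le_support_function by blast
  have "x = q" using c(2)[of "x - q"] q assms(3) c(1) by (simp add: mult_le_0_iff)
  with q show ?thesis by simp
qed

text \<open>
  Two different projections would have an interior convex combination, which could be moved closer
  to \<open>t *\<^sub>R x + (1 - t) *\<^sub>R y\<close>. With a common projection, the claim reduces to
  strictness of the support function.
\<close>

lemma gen_dist_constant_imp_zero:
  assumes "normally_smooth F" and Q: "strictly_convex_set Q" "Q \<noteq> {}"
    and t: "0 < t" "t < 1" and "x \<noteq> y"
    and eq: "gen_dist F x Q = r" "gen_dist F y Q = r"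
      "gen_dist F (t *\<^sub>R x + (1 - t) *\<^sub>R y) Q = r"
  shows "r = 0"
proof (rule ccontr)
  assume "r \<noteq> 0"
  have r: "0 < r" using gen_dist_nonneg[OF Q(2), of x] eq \<open>r \<noteq> 0\<close> by simp
  have cQ: "closed Q" "convex Q" using Q(1) by (auto simp: strictly_convex_set_def)
  obtain u where u: "u \<in> Q" "support_function F (x - u) = r"
    using gen_dist_attained[OF cQ(1) Q(2), of x] eq by metis
  obtain v where v: "v \<in> Q" "support_function F (y - v) = r"
    using gen_dist_attained[OF cQ(1) Q(2), of y] eq by metis
  define z where "z = t *\<^sub>R x + (1 - t) *\<^sub>R y"
  define w where "w = t *\<^sub>R u + (1 - t) *\<^sub>R v"
  have zw: "z - w = t *\<^sub>R (x - u) + (1 - t) *\<^sub>R (y - v)"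
    by (simp add: z_def w_def algebra_simps)
  have "w \<in> Q" using convexD[OF cQ(2) u(1) v(1)] t by (simp add: w_def)
  then have "r \<le> support_function F (z - w)"
    using gen_dist_le[of w Q z] eq by (simp add: z_def)
  moreover have "support_function F (z - w) \<le> r"
    using support_function_convex_combination[of t "x - u" "y - v"] t u v
    by (simp add: zw algebra_simps)
  ultimately have szw: "support_function F (z - w) = r" by simp
  show False
  proof (cases "u = v")
    case True
    then have "x - u = y - u"
      using support_function_strict[OF assms(1) t u(2)] v(2) szw \<open>r \<noteq> 0\<close> by (simp add: zw)
    with \<open>x \<noteq> y\<close> show False by simp
  next
    case False
    then have "w \<in> interior Q"
      using Q(1) u(1) v(1) t by (simp add: strictly_convex_set_def w_def)
    then obtain e where e: "0 < e" "cball w e \<subseteq> Q"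
      unfolding mem_interior_cball by blast
    \<comment> \<open>A step of relative size \<open>s\<close> from \<open>w\<close> towards
      \<open>z\<close> has length at most \<open>e\<close>, so it stays in \<open>Q\<close>; it
      shrinks the distance to \<open>(1 - s) * r < r\<close>.\<close>
    define s where "s = e / (e + norm (z - w))"
    have s: "0 < s" "s \<le> 1" "s * norm (z - w) \<le> e"
      using e by (auto simp: s_def field_simps add_pos_nonneg)
    then have "w + s *\<^sub>R (z - w) \<in> Q"
      using e by (intro subsetD[OF e(2)]) (simp add: dist_norm)
    then have "gen_dist F z Q \<le> support_function F (z - (w + s *\<^sub>R (z - w)))"
      by (rule gen_dist_le)
    also have "z - (w + s *\<^sub>R (z - w)) = (1 - s) *\<^sub>R (z - w)" by (simp add: algebra_simps)
    finally have "r \<le> (1 - s) * r" using s eq szw by (simp add: support_function_scaleR z_def)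
    then show False using mult_pos_pos[OF s(1) r] by (simp add: algebra_simps)
  qed
qed

lemma gen_dist_coercive:
  assumes "bounded Q" "Q \<noteq> {}"
  shows "filterlim (\<lambda>x. gen_dist F x Q) at_top at_infinity"
proof -
  obtain c where c: "0 < c" "\<And>x. c * norm x \<le> support_function F x"
    using norm_le_support_function by blast
  obtain R where R: "\<And>q. q \<in> Q \<Longrightarrow> norm q \<le> R"
    using assms(1) unfolding bounded_iff by blast
  have "c * norm x + - c * R \<le> gen_dist F x Q" for x
    unfolding gen_dist_def
  proof (rule cINF_greatest[OF assms(2)])
    fix q assume "q \<in> Q"
    then have "norm x - R \<le> norm (x - q)"
      using R[of q] norm_triangle_ineq2[of x q] by linarith
    then show "c * norm x + - c * R \<le> support_function F (x - q)"
      using c(2)[of "x - q"] mult_left_mono[of "norm x - R" "norm (x - q)" c] c(1)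
      by (simp add: algebra_simps)
  qed
  moreover have "filterlim (\<lambda>x::'a. - c * R + c * norm x) at_top at_infinity"
    by (rule filterlim_tendsto_add_at_top[OF tendsto_const
          filterlim_tendsto_pos_mult_at_top[OF tendsto_const c(1) filterlim_norm_at_top]])
  ultimately show ?thesis
    by (auto elim!: filterlim_at_top_mono simp: add.commute)
qed

end

section \<open>The smoothed distance function\<close>

text \<open>The parameter occurs under the root and as the scale of log-sum-exp. Raising it first
  under the root gives the strict inequality, and raising the scale afterwards preserves it.\<close>

lemma smooth_max_dist_strict_mono:
  assumes "1 \<le> m" "0 < p" "p < q"
  shows "smooth_max_dist F m T x p < smooth_max_dist F m T x q"
proof -
  let ?a = "\<lambda>p i. sqrt ((gen_dist F x (T i))\<^sup>2 + p\<^sup>2)"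
  have "ln (\<Sum>i=1..m. exp (?a p i / p)) < ln (\<Sum>i=1..m. exp (?a q i / p))"
    using assms power_strict_mono[of p q 2]
    by (intro ln_sum_exp_strict_mono[where j = 1]) (auto simp: divide_right_mono divide_strict_right_mono)
  then have "p * ln (\<Sum>i=1..m. exp (?a p i / p)) < p * ln (\<Sum>i=1..m. exp (?a q i / p))"
    using assms by simp
  also have "\<dots> \<le> q * ln (\<Sum>i=1..m. exp (?a q i / q))"
    using assms by (intro scaled_ln_sum_exp_mono) auto
  finally show ?thesis by (simp add: smooth_max_dist_def)
qed

lemma gen_dist_le_smooth_max_dist:
  assumes "i \<in> {1..m}" "0 < p"
  shows "gen_dist F x (T i) \<le> smooth_max_dist F m T x p"
proof -
  let ?e = "\<lambda>i. exp (sqrt ((gen_dist F x (T i))\<^sup>2 + p\<^sup>2) / p)"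
  have le: "?e i \<le> (\<Sum>i=1..m. ?e i)"
    using assms by (intro member_le_sum) auto
  moreover have "0 < ?e i" by simp
  ultimately have "ln (?e i) \<le> ln (\<Sum>i=1..m. ?e i)"
    by (subst ln_le_cancel_iff) linarith+
  then have "sqrt ((gen_dist F x (T i))\<^sup>2 + p\<^sup>2) \<le> smooth_max_dist F m T x p"
    using assms by (simp add: smooth_max_dist_def field_simps)
  moreover have "gen_dist F x (T i) \<le> sqrt ((gen_dist F x (T i))\<^sup>2 + p\<^sup>2)"
    by (rule real_le_rsqrt) simp
  ultimately show ?thesis by linarith
qed

context gauge_body
begin

text \<open>For the upper bound, each root is at most the distance plus \<open>p\<close>, so each of
  the \<open>m\<close> exponentials is at most \<open>exp (?D / p + 1)\<close>.\<close>

lemma smooth_max_dist_bounds: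
  assumes "1 \<le> m" "0 < p" and T: "\<And>i. i \<in> {1..m} \<Longrightarrow> T i \<noteq> {}"
  shows "max_dist F m T x \<le> smooth_max_dist F m T x p"
    and "smooth_max_dist F m T x p \<le> max_dist F m T x + p * (1 + ln (real m))"
proof -
  show "max_dist F m T x \<le> smooth_max_dist F m T x p"
    unfolding max_dist_def using assms gen_dist_le_smooth_max_dist[where T = T]
    by (intro Max.boundedI) auto
  let ?D = "max_dist F m T x"
  have "exp (sqrt ((gen_dist F x (T i))\<^sup>2 + p\<^sup>2) / p) \<le> exp (?D / p + 1)" if i: "i \<in> {1..m}" for i
  proof -
    have "sqrt ((gen_dist F x (T i))\<^sup>2 + p\<^sup>2) \<le> gen_dist F x (T i) + p"
      using gen_dist_nonneg[OF T[OF i]] \<open>0 < p\<close> by (intro sqrt_sum_squares_le_sum) auto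
    moreover have "gen_dist F x (T i) \<le> ?D"
      unfolding max_dist_def using i by (intro Max_ge) auto
    ultimately show ?thesis using \<open>0 < p\<close> by (simp add: field_simps)
  qed
  then have "(\<Sum>i=1..m. exp (sqrt ((gen_dist F x (T i))\<^sup>2 + p\<^sup>2) / p)) \<le> (\<Sum>i=1..m. exp (?D / p + 1))"
    by (rule sum_mono)
  then have "ln (\<Sum>i=1..m. exp (sqrt ((gen_dist F x (T i))\<^sup>2 + p\<^sup>2) / p)) \<le> ln (real m * exp (?D / p + 1))"
    using assms(1) by (subst ln_le_cancel_iff) (auto intro!: sum_pos)
  also have "\<dots> = ln (real m) + (?D / p + 1)"
    using assms(1) by (simp add: ln_mult)
  finally have "p * ln (\<Sum>i=1..m. exp (sqrt ((gen_dist F x (T i))\<^sup>2 + p\<^sup>2) / p)) \<le> p * (ln (real m) + (?D / p + 1))"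
    using assms(2) by (intro mult_left_mono) auto
  also have "\<dots> = ?D + p * (1 + ln (real m))"
    using assms(2) by (simp add: field_simps)
  finally show "smooth_max_dist F m T x p \<le> ?D + p * (1 + ln (real m))"
    by (simp add: smooth_max_dist_def)
qed

context
  fixes T :: "nat \<Rightarrow> 'a set" and m :: nat and p :: real
  assumes m: "1 \<le> m" and p: "0 < p"
    and nonempty: "\<And>i. i \<in> {1..m} \<Longrightarrow> T i \<noteq> {}"
    and closed: "\<And>i. i \<in> {1..m} \<Longrightarrow> closed (T i)"
    and convex: "\<And>i. i \<in> {1..m} \<Longrightarrow> convex (T i)"
begin

text \<open>Log-sum-exp of the averaged exponents is interposed as \<open>r\<close>. Its convexity
  bounds \<open>r\<close> above, and convexity of the roots bounds the left side by
  \<open>r\<close>; strictness in a single index \<open>j\<close> makes the latter step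
  strict.\<close>

lemma smooth_max_dist_convex_combination:
  assumes t: "0 < t" "t < 1"
  defines "z \<equiv> \<lambda>x y. t *\<^sub>R x + (1 - t) *\<^sub>R y"
  shows "smooth_max_dist F m T (z x y) p \<le>
      t * smooth_max_dist F m T x p + (1 - t) * smooth_max_dist F m T y p"
    and "\<lbrakk>j \<in> {1..m}; gen_dist F x (T j) \<noteq> gen_dist F y (T j) \<or>
        gen_dist F (z x y) (T j) \<noteq> gen_dist F x (T j)\<rbrakk> \<Longrightarrow>
      smooth_max_dist F m T (z x y) p <
      t * smooth_max_dist F m T x p + (1 - t) * smooth_max_dist F m T y p"
proof -
  define s where "s x i = sqrt ((gen_dist F x (T i))\<^sup>2 + p\<^sup>2)" for x i
  define r where "r = ln (\<Sum>i=1..m. exp (t * (s x i / p) + (1 - t) * (s y i / p)))"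
  have "r \<le> t * ln (\<Sum>i=1..m. exp (s x i / p)) + (1 - t) * ln (\<Sum>i=1..m. exp (s y i / p))"
    unfolding r_def using m t by (intro ln_sum_exp_convex) auto
  then have "p * r \<le> p * (t * ln (\<Sum>i=1..m. exp (s x i / p)) + (1 - t) * ln (\<Sum>i=1..m. exp (s y i / p)))"
    using p by simp
  then have r: "p * r \<le> t * smooth_max_dist F m T x p + (1 - t) * smooth_max_dist F m T y p"
    by (simp add: smooth_max_dist_def s_def algebra_simps)
  have gen: "0 \<le> gen_dist F (z x y) (T i)"
    "gen_dist F (z x y) (T i) \<le> t * gen_dist F x (T i) + (1 - t) * gen_dist F y (T i)"
    if "i \<in> {1..m}" for i
    unfolding z_def using that t nonempty closed convex
    by (auto intro!: gen_dist_nonneg gen_dist_convex_combination)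
  have s: "s (z x y) i / p \<le> t * (s x i / p) + (1 - t) * (s y i / p)" if "i \<in> {1..m}" for i
    using sqrt_sum_power2_convex_mono(1)[OF p t gen[OF that]] p
    by (simp add: s_def field_simps)
  have "ln (\<Sum>i=1..m. exp (s (z x y) i / p)) \<le> r"
    unfolding r_def using m s by (intro ln_sum_exp_mono) auto
  then have "smooth_max_dist F m T (z x y) p \<le> p * r"
    using p by (simp add: smooth_max_dist_def s_def)
  with r show "smooth_max_dist F m T (z x y) p \<le>
      t * smooth_max_dist F m T x p + (1 - t) * smooth_max_dist F m T y p"
    by linarith
  assume j: "j \<in> {1..m}" "gen_dist F x (T j) \<noteq> gen_dist F y (T j) \<or>
      gen_dist F (z x y) (T j) \<noteq> gen_dist F x (T j)"
  have "s (z x y) j / p < t * (s x j / p) + (1 - t) * (s y j / p)"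
    using sqrt_sum_power2_convex_mono(2)[OF p t gen[OF j(1)] j(2)] p
    by (simp add: s_def field_simps)
  then have "ln (\<Sum>i=1..m. exp (s (z x y) i / p)) < r"
    unfolding r_def using s j by (intro ln_sum_exp_strict_mono) auto
  then have "smooth_max_dist F m T (z x y) p < p * r"
    using p by (simp add: smooth_max_dist_def s_def)
  with r show "smooth_max_dist F m T (z x y) p <
      t * smooth_max_dist F m T x p + (1 - t) * smooth_max_dist F m T y p"
    by linarith
qed

lemma convex_on_smooth_max_dist: "convex_on UNIV (\<lambda>x. smooth_max_dist F m T x p)"
proof (rule convex_onI)
  fix t x y assume "0 < (t::real)" "t < 1"
  then show "smooth_max_dist F m T ((1 - t) *\<^sub>R x + t *\<^sub>R y) p \<le>
      (1 - t) * smooth_max_dist F m T x p + t * smooth_max_dist F m T y p"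
    using smooth_max_dist_convex_combination(1)[of "1 - t" x y] by simp
qed simp

lemma strictly_convex_smooth_max_dist:
  assumes "normally_smooth F" "\<And>i. i \<in> {1..m} \<Longrightarrow> strictly_convex_set (T i)"
    and "\<not> collinear_sets m T"
  shows "strictly_convex_fun (\<lambda>x. smooth_max_dist F m T x p)"
  unfolding strictly_convex_fun_def
proof (intro allI impI, elim conjE)
  fix x y :: 'a and t :: real
  assume "x \<noteq> y" and t: "0 < t" "t < 1"
  define z where "z = t *\<^sub>R x + (1 - t) *\<^sub>R y"
  \<comment> \<open>Otherwise every distance takes one value at \<open>x\<close>, \<open>y\<close>
    and \<open>z\<close>, which must be \<open>0\<close>. Then \<open>x\<close> lies in every
    target, and the line through \<open>x\<close> and \<open>y\<close> contradicts
    noncollinearity.\<close>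
  have "\<exists>j\<in>{1..m}. gen_dist F x (T j) \<noteq> gen_dist F y (T j) \<or> gen_dist F z (T j) \<noteq> gen_dist F x (T j)"
  proof (rule ccontr)
    assume "\<not> ?thesis"
    then have "gen_dist F x (T i) = 0" if "i \<in> {1..m}" for i
      using gen_dist_constant_imp_zero[OF assms(1,2) nonempty t \<open>x \<noteq> y\<close>, of i] that
      unfolding z_def by auto
    then have "x \<in> T i" if "i \<in> {1..m}" for i
      using gen_dist_zero_imp_mem[OF closed[OF that] nonempty[OF that]] that by blast
    then have "\<forall>i\<in>{1..m}. affine hull {x, y} \<inter> T i \<noteq> {}"
      using hull_inc[of x "{x, y}" affine] by blast
    moreover have "aff_dim (affine hull {x, y}) = 1"
      using \<open>x \<noteq> y\<close> by (simp add: aff_dim_affine_hull aff_dim_2)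
    ultimately show False
      using assms(3) affine_affine_hull unfolding collinear_sets_def by blast
  qed
  then show "smooth_max_dist F m T (t *\<^sub>R x + (1 - t) *\<^sub>R y) p <
      t * smooth_max_dist F m T x p + (1 - t) * smooth_max_dist F m T y p"
    using smooth_max_dist_convex_combination(2)[OF t] unfolding z_def by blast
qed

text \<open>
  Replacing each distance by the gauge distance to a fixed projection of \<open>x\<close> gives a
  differentiable majorant that touches at \<open>x\<close>.
\<close>

lemma smooth_max_dist_differentiable:
  assumes "normally_smooth F" "normally_round F"
  shows "(\<lambda>x. smooth_max_dist F m T x p) differentiable (at x)"
proof -
  have "\<forall>i\<in>{1..m}. \<exists>q\<in>T i. gen_dist F x (T i) = support_function F (x - q)"
    using gen_dist_attained[OF closed nonempty] by metis
  then obtain u where u: "\<And>i. i \<in> {1..m} \<Longrightarrow> u i \<in> T i"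
    "\<And>i. i \<in> {1..m} \<Longrightarrow> gen_dist F x (T i) = support_function F (x - u i)"
    by metis
  define \<sigma> where "\<sigma> y i = (support_function F (y - u i))\<^sup>2" for y i
  define \<psi> where "\<psi> y = p * ln (\<Sum>i=1..m. exp (sqrt (\<sigma> y i + p\<^sup>2) / p))" for y
  \<comment> \<open>Stated for every \<open>i\<close>, also outside the index range, so that the
    rule for sums applies directly. As \<open>p > 0\<close>, the root is taken at a positive number,
    away from its singularity.\<close>
  have "\<exists>D. ((\<lambda>y. exp (sqrt (\<sigma> y i + p\<^sup>2) / p)) has_derivative D) (at x)" for i
  proof -
    obtain D where D: "((\<lambda>y. (support_function F y)\<^sup>2) has_derivative D) (at (x - u i))"
      using support_function_power2_differentiable[OF assms] unfolding differentiable_def by blast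
    have "((\<lambda>y. y - u i) has_derivative (\<lambda>h. h)) (at x)"
      by (auto intro!: derivative_eq_intros)
    from has_derivative_compose[OF this D] have "((\<lambda>y. \<sigma> y i) has_derivative D) (at x)"
      by (simp add: \<sigma>_def)
    moreover have "0 < \<sigma> x i + p\<^sup>2"
      using p by (simp add: \<sigma>_def add_nonneg_pos)
    ultimately show ?thesis
      using p by (intro exI) (rule derivative_intros refl | simp)+
  qed
  then obtain D where D: "\<And>i. ((\<lambda>y. exp (sqrt (\<sigma> y i + p\<^sup>2) / p)) has_derivative D i) (at x)"
    by metis
  have "0 < (\<Sum>i=1..m. exp (sqrt (\<sigma> x i + p\<^sup>2) / p))"
    using m by (intro sum_pos) auto
  from has_derivative_mult_right[OF has_derivative_ln[OF this has_derivative_sum[OF D]]]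
  have "\<exists>E. (\<psi> has_derivative E) (at x)"
    unfolding \<psi>_def[abs_def] by blast
  moreover have "smooth_max_dist F m T y p \<le> \<psi> y" for y
  proof -
    have "sqrt ((gen_dist F y (T i))\<^sup>2 + p\<^sup>2) \<le> sqrt (\<sigma> y i + p\<^sup>2)" if "i \<in> {1..m}" for i
      using gen_dist_le[OF u(1)[OF that], of y] gen_dist_nonneg[OF nonempty[OF that], of y]
      by (simp add: \<sigma>_def power_mono)
    then show ?thesis
      unfolding smooth_max_dist_def \<psi>_def using m p
      by (intro mult_left_mono ln_sum_exp_mono) (auto simp: divide_right_mono)
  qed
  moreover have "smooth_max_dist F m T x p = \<psi> x"
    unfolding smooth_max_dist_def \<psi>_def \<sigma>_def using u(2) by (auto intro!: arg_cong[where f = ln] sum.cong)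
  ultimately show ?thesis
    using convex_on_has_derivative_sandwich[OF convex_on_smooth_max_dist]
    unfolding differentiable_def by blast
qed

end

end

theorem theorem3p6:
  fixes F \<Omega> :: "(real ^ 'n) set" and T :: "nat \<Rightarrow> (real ^ 'n) set" and m :: nat
  assumes "closed F" and "bounded F" and "convex F" and "0 \<in> interior F"
    and "1 \<le> m"
    and "\<Omega> \<noteq> {}" and "closed \<Omega>" and "convex \<Omega>"
    and "\<And>i. i \<in> {1..m} \<Longrightarrow> T i \<noteq> {}"
    and "\<And>i. i \<in> {1..m} \<Longrightarrow> closed (T i)"
    and "\<And>i. i \<in> {1..m} \<Longrightarrow> convex (T i)"
    and "(\<Inter>i\<in>{1..m}. \<Omega> \<inter> T i) = {}"
    and "bounded \<Omega> \<or> (\<exists>i\<in>{1..m}. bounded (T i))"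
  shows
    "(\<forall>x p1 p2. 0 < p1 \<and> p1 < p2 \<longrightarrow> smooth_max_dist F m T x p1 < smooth_max_dist F m T x p2)
   \<and> (\<forall>x p. 0 < p \<longrightarrow>
        0 \<le> smooth_max_dist F m T x p - max_dist F m T x \<and>
        smooth_max_dist F m T x p - max_dist F m T x \<le> p * (1 + ln (real m)))
   \<and> (\<forall>p>0. convex_on UNIV (\<lambda>x. smooth_max_dist F m T x p) \<and>
        (normally_smooth F \<and> (\<forall>i\<in>{1..m}. strictly_convex_set (T i)) \<and> \<not> collinear_sets m T \<longrightarrow>
           strictly_convex_fun (\<lambda>x. smooth_max_dist F m T x p)))
   \<and> (\<forall>p>0. normally_smooth F \<and> normally_round F \<longrightarrow>
        continuously_differentiable (\<lambda>x. smooth_max_dist F m T x p))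
   \<and> ((\<exists>i\<in>{1..m}. bounded (T i)) \<longrightarrow>
        (\<forall>p>0. filterlim (\<lambda>x. smooth_max_dist F m T x p) at_top at_infinity))"
proof -
  interpret gauge_body F
    using assms(1,2,4) by unfold_locales (simp_all add: compact_eq_bounded_closed)
  note T = assms(9-11)
  show ?thesis
  \<comment> \<open>Case 1 is (i), cases 2 and 3 are the two bounds of (ii), cases 4 and 5 are
    convexity and strict convexity in (iii), case 6 is (iv) and case 7 is (v).\<close>
  proof (intro conjI allI impI, goal_cases)
    case (1 x p1 p2)
    then show ?case using smooth_max_dist_strict_mono[OF assms(5)] by blast
  next
    case (2 x p)
    then show ?case using smooth_max_dist_bounds(1)[where T = T, OF assms(5) _ T(1)] by simp
  next
    case (3 x p)
    then show ?case using smooth_max_dist_bounds(2)[where T = T and x = x, OF assms(5) _ T(1), of p] by simp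
  next
    case (4 p)
    then show ?case by (rule convex_on_smooth_max_dist[where T = T, OF assms(5) _ T])
  next
    case (5 p)
    show ?case
      by (rule strictly_convex_smooth_max_dist[where T = T, OF assms(5) 5(1) T]) (use 5 in auto)
  next
    case (6 p)
    show ?case
    proof (rule convex_on_differentiable_imp_continuously_differentiable)
      show "convex_on UNIV (\<lambda>x. smooth_max_dist F m T x p)"
        by (rule convex_on_smooth_max_dist[where T = T, OF assms(5) 6(1) T])
      show "(\<lambda>x. smooth_max_dist F m T x p) differentiable (at x)" for x
        by (rule smooth_max_dist_differentiable[where T = T, OF assms(5) 6(1) T]) (use 6 in auto)
    qed
  next
    case (7 p)
    \<comment> \<open>The distance to a single bounded target is coercive and lies below the
      smoothed maximum.\<close>
    then obtain i where i: "i \<in> {1..m}" "bounded (T i)" by blast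
    then have "filterlim (\<lambda>x. gen_dist F x (T i)) at_top at_infinity"
      using gen_dist_coercive T(1) by blast
    then show ?case
      using gen_dist_le_smooth_max_dist[where T = T, OF i(1) 7(2)]
      by (auto elim!: filterlim_at_top_mono)
  qed
qed

end
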